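(* Let $s<t$ be real numbers and let $\alpha>\beta\ge0$ be real numbers. The double inequality $$\exp\left[t-s+\frac{\psi'(x+s+\alpha)-\psi'(x+t+\alpha)}{12}\right]\le\frac{\Gamma(x+s)}{\Gamma(x+t)}\cdot\frac{(x+t)^{x+t-1/2}}{(x+s)^{x+s-1/2}}\le\exp\left[t-s+\frac{\psi'(x+s+\beta)-\psi'(x+t+\beta)}{12}\right]$$ is valid for all $x\in(-s,\infty)$ if and only if $\beta=0$ and $\alpha\ge\frac12$.
   Context: $\Gamma(x)=\int_0^\infty t^{x-1}e^{-t}\,dt$ for $x>0$ is the gamma function, $\psi(x)=\Gamma'(x)/\Gamma(x)$ is the di-gamma function, and $\psi'$ is its derivative (the tri-gamma function). *)

theory Defs
  imports "HOL-Analysis.Analysis"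
begin

text \<open>
  The library defines \<open>Gamma\<close> by a limit and \<open>Digamma\<close> by a series. On the positive reals they
  agree with the Euler integral and with the logarithmic derivative of \<open>Gamma\<close>, and
  \<open>deriv Digamma\<close> is \<open>Polygamma 1\<close>:
\<close>

lemma Gamma_Euler_integral:
  fixes x :: real
  assumes "x > 0"
  shows "((\<lambda>t. t powr (x - 1) / exp t) has_integral Gamma x) {0..}"
  using Gamma_integral_real[OF assms] .

lemma Digamma_eq_deriv_Gamma_div:
  fixes x :: real
  assumes "x > 0"
  shows "Digamma x = deriv Gamma x / Gamma x"
proof -
  have "x \<notin> \<int>\<^sub>\<le>\<^sub>0" using assms by (auto elim!: nonpos_Ints_cases)
  hence "deriv Gamma x = Gamma x * Digamma x"
    by (intro DERIV_imp_deriv has_field_derivative_Gamma)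
  moreover have "Gamma x > 0" using assms by (rule Gamma_real_pos)
  ultimately show ?thesis by simp
qed

lemma deriv_Digamma_eq_Polygamma:
  fixes x :: real
  assumes "x > 0"
  shows "(Digamma has_field_derivative deriv Digamma x) (at x)"
    and "deriv Digamma x = Polygamma 1 x"
proof -
  have "x \<notin> \<int>\<^sub>\<le>\<^sub>0" using assms by (auto elim!: nonpos_Ints_cases)
  hence D: "(Digamma has_field_derivative Polygamma 1 x) (at x)"
    using has_field_derivative_Polygamma[of x 0 UNIV] by simp
  show E: "deriv Digamma x = Polygamma 1 x" by (rule DERIV_imp_deriv[OF D])
  show "(Digamma has_field_derivative deriv Digamma x) (at x)" using D E by simp
qed

end

(*
  Let f_a(x) = ln Gamma(x) - (x - 1/2) ln x + x - psi'(x + a)/12. Taking logarithms, the double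
  inequality says that f_alpha(u) >= f_alpha(u + h) and f_beta(u) <= f_beta(u + h) for all u > 0,
  where h = t - s. The difference f_a(x) - f_a(x + 1) is elementary, its second derivative is
  1/(2 x^2 (x + 1)^2) - 1/(2 (x + a)^4), and f_a(x) - f_a(x + h) tends to 0 as x tends to infinity.
  So on every half-line (c, oo) on which (x + a)^2 - x(x + 1) has constant sign, f_a is monotone:
  increasing on (0, oo) for a = 0, decreasing on (0, oo) for a >= 1/2, and increasing near
  infinity for 0 < a < 1/2. Hence alpha >= 1/2 is necessary; beta = 0 is necessary because
  f_beta tends to infinity at 0 for beta > 0.
*)
theory Submission
  imports Defs "HOL-Real_Asymp.Real_Asymp"
begin

section \<open>The Stirling remainder, its unit-step difference and two derivatives\<close>

text \<open>Apart from the trigamma term this is, for \<open>x > 0\<close>, Binet's function plus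
  the constant \<open>ln (2 * pi) / 2\<close>, which cancels in differences.\<close>

definition stirling_rem :: "real \<Rightarrow> real \<Rightarrow> real" where
  "stirling_rem a x = ln_Gamma x - (x - 1/2) * ln x + x - Polygamma 1 (x + a) / 12"

text \<open>Closed form of \<open>stirling_rem a x - stirling_rem a (x + 1)\<close> for
  \<open>x > 0\<close> and \<open>a \<ge> 0\<close>: the recurrences of \<open>ln_Gamma\<close> and
  \<open>Polygamma 1\<close> eliminate both special functions.\<close>

definition stirling_diff :: "real \<Rightarrow> real \<Rightarrow> real" where
  "stirling_diff a x = (x + 1/2) * (ln (x + 1) - ln x) - 1 - 1 / (12 * (x + a)\<^sup>2)"

definition stirling_diff' :: "real \<Rightarrow> real \<Rightarrow> real" where
  "stirling_diff' a x = ln (x + 1) - ln x - (1 / x + 1 / (x + 1)) / 2 + 1 / (6 * (x + a) ^ 3)"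

lemma pos_not_nonpos_Int: "x > 0 \<Longrightarrow> x \<notin> \<int>\<^sub>\<le>\<^sub>0" for x :: real
  by (auto elim!: nonpos_Ints_cases)

lemma ln_Gamma_plus1:
  fixes x :: real
  assumes "x > 0"
  shows "ln_Gamma (x + 1) = ln_Gamma x + ln x"
  using assms pos_not_nonpos_Int[OF assms] Gamma_real_pos[OF assms]
  by (simp add: ln_Gamma_real_pos Gamma_plus1 ln_mult_pos)

lemma stirling_rem_diff:
  assumes "x > 0" "a \<ge> 0"
  shows "stirling_rem a x - stirling_rem a (x + 1) = stirling_diff a x"
proof -
  have "Polygamma 1 (x + 1 + a) = Polygamma 1 (x + a) - 1 / (x + a)\<^sup>2"
    using Polygamma_plus1[of "x + a" 1] assms by (simp add: add_ac numeral_2_eq_2)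
  thus ?thesis
    unfolding stirling_rem_def stirling_diff_def ln_Gamma_plus1[OF assms(1)]
    by (simp add: algebra_simps diff_divide_distrib add_divide_distrib)
qed

lemma has_field_derivative_stirling_diff:
  assumes "x > 0" "a \<ge> 0"
  shows "(stirling_diff a has_field_derivative stirling_diff' a x) (at x)"
proof -
  have xa: "x + a \<noteq> 0" using assms by simp
  have "((\<lambda>x. (x + 1/2) * (ln (x + 1) - ln x) - 1 - 1 / (12 * (x + a)\<^sup>2))
     has_field_derivative (ln (x + 1) - ln x + (x + 1/2) * (1/(x+1) - 1/x)
        + 12 * (2 * (x + a)) / (12 * (x + a)\<^sup>2)\<^sup>2)) (at x)"
    using assms xa by (auto intro!: derivative_eq_intros simp: power2_eq_square)
      (simp add: divide_simps)
  moreover have "(x + 1/2) * (1/(x+1) - 1/x) = - ((1 / x + 1 / (x + 1)) / 2)"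
    using assms by (simp add: divide_simps) (simp add: algebra_simps)
  moreover have "12 * (2 * y) / (12 * y\<^sup>2)\<^sup>2 = 1 / (6 * y ^ 3)" if "y \<noteq> 0" for y :: real
    using that by (simp add: divide_simps power2_eq_square power3_eq_cube)
  note this[OF xa]
  ultimately show ?thesis
    unfolding stirling_diff_def[abs_def] stirling_diff'_def by simp
qed

text \<open>The second differentiation removes the logarithms. With \<open>q = x * (x + 1)\<close>
  and \<open>p = (x + a)^2\<close> the result is \<open>1 / (2 * q^2) - 1 / (2 * p^2)\<close>, which
  has the sign of \<open>p - q\<close>.\<close>

lemma has_field_derivative_stirling_diff':
  assumes "x > 0" "a \<ge> 0"
  shows "(stirling_diff' a has_field_derivative
            1 / (2 * (x * (x + 1))\<^sup>2) - 1 / (2 * (x + a) ^ 4)) (at x)"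
proof -
  have xa: "x + a \<noteq> 0" using assms by simp
  have "((\<lambda>x. ln (x + 1) - ln x - (1 / x + 1 / (x + 1)) / 2 + 1 / (6 * (x + a) ^ 3))
     has_field_derivative (1/(x+1) - 1/x - (- (1/x\<^sup>2) - 1/(x+1)\<^sup>2) / 2
        - 6 * (3 * (x + a)\<^sup>2) / (6 * (x + a) ^ 3)\<^sup>2)) (at x)"
    using assms xa by (auto intro!: derivative_eq_intros simp: power2_eq_square)
  moreover have "1/(x+1) - 1/x - (- (1/x\<^sup>2) - 1/(x+1)\<^sup>2) / 2 = 1 / (2 * (x * (x + 1))\<^sup>2)"
    using assms by (simp add: divide_simps) (simp add: algebra_simps power2_eq_square)
  moreover have "6 * (3 * y\<^sup>2) / (6 * y ^ 3)\<^sup>2 = 1 / (2 * y ^ 4)" if "y \<noteq> 0" for y :: real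
    using that by (simp add: divide_simps power2_eq_square power3_eq_cube power4_eq_xxxx)
  note this[OF xa]
  ultimately show ?thesis
    unfolding stirling_diff'_def[abs_def] by simp
qed

section \<open>Monotonicity of the unit-step difference\<close>

lemma stirling_diff'_tendsto: "(stirling_diff' a \<longlongrightarrow> 0) at_top"
  unfolding stirling_diff'_def[abs_def] by real_asymp

text \<open>The sign \<open>\<sigma> = \<plusminus>1\<close> treats the increasing and the decreasing case together.\<close>

lemma stirling_diff'_sign:
  fixes \<sigma> :: real
  assumes "a \<ge> 0" "c \<ge> 0" "x > c"
    and sgn: "\<And>y. y > c \<Longrightarrow> \<sigma> * ((y + a)\<^sup>2 - y * (y + 1)) > 0"
  shows "\<sigma> * stirling_diff' a x < 0"
proof -
  have inc: "\<sigma> * stirling_diff' a y < \<sigma> * stirling_diff' a z" if "c < y" "y < z" for y z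
  proof (rule DERIV_pos_imp_increasing[OF that(2)])
    fix w assume w: "y \<le> w" "w \<le> z"
    hence "w > c" "w > 0" using that assms by auto
    define p q where "p = (w + a)\<^sup>2" and "q = w * (w + 1)"
    have pq: "p > 0" "q > 0" using \<open>w > 0\<close> assms by (auto simp: p_def q_def)
    \<comment> \<open>Factoring out \<open>p - q\<close> exposes the sign given by
      \<open>sgn\<close>; the remaining factor is positive.\<close>
    have "\<sigma> * (1 / (2 * q\<^sup>2) - 1 / (2 * p\<^sup>2)) = \<sigma> * (p - q) * ((p + q) / (2 * p\<^sup>2 * q\<^sup>2))"
      using pq by (simp add: divide_simps) (simp add: algebra_simps power2_eq_square)
    moreover have "\<sigma> * (p - q) * ((p + q) / (2 * p\<^sup>2 * q\<^sup>2)) > 0"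
      using sgn[OF \<open>w > c\<close>] pq unfolding p_def[symmetric] q_def[symmetric]
      by (intro mult_pos_pos[of _ "_ / _"] divide_pos_pos) auto
    ultimately have "\<sigma> * (1 / (2 * (w * (w + 1))\<^sup>2) - 1 / (2 * (w + a) ^ 4)) > 0"
      by (simp add: p_def q_def)
    moreover have "((\<lambda>x. \<sigma> * stirling_diff' a x) has_field_derivative
        \<sigma> * (1 / (2 * (w * (w + 1))\<^sup>2) - 1 / (2 * (w + a) ^ 4))) (at w)"
      by (intro DERIV_cmult has_field_derivative_stirling_diff' \<open>w > 0\<close> assms)
    ultimately show "\<exists>d. ((\<lambda>x. \<sigma> * stirling_diff' a x) has_real_derivative d) (at w) \<and> d > 0"
      by blast
  qed
  \<comment> \<open>An increasing function with limit 0 is at most 0. This is applied at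
    \<open>x + 1\<close>, so that \<open>inc\<close> from \<open>x\<close> to \<open>x + 1\<close>
    makes the inequality strict at \<open>x\<close>.\<close>
  have "((\<lambda>y. \<sigma> * stirling_diff' a y) \<longlongrightarrow> \<sigma> * 0) at_top"
    by (intro tendsto_intros stirling_diff'_tendsto)
  moreover have "eventually (\<lambda>y. \<sigma> * stirling_diff' a (x + 1) \<le> \<sigma> * stirling_diff' a y) at_top"
    using eventually_gt_at_top[of "x + 1"]
    by eventually_elim (use inc[of "x + 1"] assms in force)
  ultimately have "\<sigma> * stirling_diff' a (x + 1) \<le> \<sigma> * 0"
    by (rule tendsto_lowerbound) simp
  with inc[of x "x + 1"] assms show ?thesis by simp
qed

lemma stirling_diff_strict_mono:
  fixes \<sigma> :: real
  assumes "a \<ge> 0" "c \<ge> 0" "c < x" "x < y"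
    and sgn: "\<And>y. y > c \<Longrightarrow> \<sigma> * ((y + a)\<^sup>2 - y * (y + 1)) > 0"
  shows "\<sigma> * stirling_diff a y < \<sigma> * stirling_diff a x"
proof (rule DERIV_neg_imp_decreasing[OF assms(4)])
  fix w assume w: "x \<le> w" "w \<le> y"
  have "((\<lambda>x. \<sigma> * stirling_diff a x) has_field_derivative \<sigma> * stirling_diff' a w) (at w)"
    by (intro DERIV_cmult has_field_derivative_stirling_diff) (use w assms in auto)
  moreover have "\<sigma> * stirling_diff' a w < 0"
    using stirling_diff'_sign[OF assms(1,2) _ sgn, of w] w assms(3) by auto
  ultimately show "\<exists>d. ((\<lambda>x. \<sigma> * stirling_diff a x) has_real_derivative d) (at w) \<and> d < 0"
    by blast
qed

section \<open>Digamma and trigamma at infinity\<close>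

text \<open>The mean value theorem for \<open>ln_Gamma\<close> on \<open>[x, x + 1]\<close> gives
  \<open>ln x = Digamma z\<close> with \<open>z\<close> in between. As \<open>Digamma\<close> is
  increasing, \<open>Digamma x \<le> ln x \<le> Digamma (x + 1) = Digamma x + 1 / x\<close>.\<close>

lemma Digamma_bounds:
  fixes x :: real
  assumes "x > 0"
  shows "ln x - 1 / x \<le> Digamma x" "Digamma x \<le> ln x"
proof -
  have "\<exists>z. z > x \<and> z < x + 1 \<and> ln_Gamma (x + 1) - ln_Gamma x = (x + 1 - x) * Digamma z"
    by (rule MVT2) (use assms in \<open>auto intro!: derivative_eq_intros\<close>)
  then obtain z where z: "z > x" "z < x + 1" "Digamma z = ln x"
    using ln_Gamma_plus1[OF assms] by auto
  show "Digamma x \<le> ln x" using Digamma_real_mono[of x z] z assms by simp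
  have "ln x \<le> Digamma (x + 1)" using Digamma_real_mono[of z "x + 1"] z assms by simp
  thus "ln x - 1 / x \<le> Digamma x" using Digamma_plus1[of x] assms by simp
qed

lemma Polygamma_1_tendsto_0: "(Polygamma 1 \<longlongrightarrow> (0::real)) at_top"
proof (rule tendsto_sandwich)
  show "eventually (\<lambda>x::real. 0 \<le> Polygamma 1 x) at_top"
    using eventually_gt_at_top[of 0]
    by eventually_elim (use Polygamma_real_odd_pos[of _ 1] pos_not_nonpos_Int in \<open>force intro: less_imp_le\<close>)
next
  txt \<open>By the mean value theorem \<open>\<psi>'(x) \<le> \<psi>(x) - \<psi>(x - 1)\<close>.\<close>
  show "eventually (\<lambda>x::real. Polygamma 1 x \<le> ln x - ln (x - 1) + 1 / (x - 1)) at_top"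
    using eventually_gt_at_top[of 1]
  proof eventually_elim
    case (elim x)
    have "\<exists>z. z > x - 1 \<and> z < x \<and> Digamma x - Digamma (x - 1) = (x - (x - 1)) * Polygamma 1 z"
    proof (rule MVT2)
      fix w :: real assume "x - 1 \<le> w" "w \<le> x"
      hence "w \<notin> \<int>\<^sub>\<le>\<^sub>0" using elim by (intro pos_not_nonpos_Int) auto
      thus "(Digamma has_real_derivative Polygamma 1 w) (at w)"
        using has_field_derivative_Polygamma[of w 0 UNIV] by simp
    qed simp
    then obtain z where z: "z > x - 1" "z < x" "Polygamma 1 z = Digamma x - Digamma (x - 1)"
      by auto
    have "Polygamma 1 x < Polygamma 1 z"
      by (rule Polygamma_real_strict_antimono) (use z elim in auto)
    \<comment> \<open>The upper bound is used at \<open>x\<close>, the lower bound at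
      \<open>x - 1\<close>.\<close>
    thus ?case using z(3) Digamma_bounds[of x] Digamma_bounds[of "x - 1"] elim by simp
  qed
qed (simp, real_asymp)

text \<open>The trigamma terms vanish separately. For the rest, \<open>g\<close>, the derivative is
  O(1/x), so the mean value theorem bounds the change over a step \<open>h\<close> by
  \<open>h / x\<close>.\<close>

lemma stirling_rem_shift_tendsto:
  assumes "h > 0"
  shows "((\<lambda>x. stirling_rem a x - stirling_rem a (x + h)) \<longlongrightarrow> 0) at_top"
proof -
  define g where "g x = ln_Gamma x - (x - 1/2) * ln x + x" for x :: real
  have g: "((\<lambda>x. g x - g (x + h)) \<longlongrightarrow> 0) at_top"
  proof (rule Lim_null_comparison)
    show "eventually (\<lambda>x. norm (g x - g (x + h)) \<le> h / x) at_top"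
      using eventually_gt_at_top[of 0]
    proof eventually_elim
      case (elim x)
      have "\<exists>z. z > x \<and> z < x + h \<and>
        g (x + h) - g x = (x + h - x) * (Digamma z - ln z + 1 / (2 * z))"
      proof (rule MVT2)
        fix w assume "x \<le> w" "w \<le> x + h"
        hence "w > 0" using elim by simp
        thus "(g has_real_derivative Digamma w - ln w + 1 / (2 * w)) (at w)"
          unfolding g_def by (auto intro!: derivative_eq_intros simp: field_simps)
      qed (use assms in simp)
      then obtain z where z: "z > x" "g (x + h) - g x = h * (Digamma z - ln z + 1 / (2 * z))"
        by auto
      \<comment> \<open>\<open>Digamma z - ln z\<close> lies between \<open>- (1 / z)\<close> and 0,
        so adding half of \<open>1 / z\<close> keeps the absolute value below
        \<open>1 / z\<close>.\<close>
      have "\<bar>Digamma z - ln z + 1 / (2 * z)\<bar> \<le> 1 / z"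
      proof -
        have "1 / (2 * z) = (1 / z) / 2" "1 / z > 0" using z elim by auto
        thus ?thesis using Digamma_bounds[of z] z elim unfolding abs_le_iff by linarith
      qed
      also have "\<dots> \<le> 1 / x" using z elim by (simp add: frac_le)
      finally have "h * \<bar>Digamma z - ln z + 1 / (2 * z)\<bar> \<le> h * (1 / x)"
        using assms by (intro mult_left_mono) auto
      moreover have "norm (g x - g (x + h)) = h * \<bar>Digamma z - ln z + 1 / (2 * z)\<bar>"
        using z(2) assms by (simp add: abs_minus_commute[of "g x"] abs_mult)
      ultimately show ?case by simp
    qed
  qed real_asymp
  have shift: "((\<lambda>x. Polygamma 1 (x + b)) \<longlongrightarrow> 0) at_top" for b :: real
    by (rule filterlim_compose[OF Polygamma_1_tendsto_0]) real_asymp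
  have "((\<lambda>x. (g x - g (x + h)) - Polygamma 1 (x + a) / 12 + Polygamma 1 (x + (h + a)) / 12)
          \<longlongrightarrow> 0 - 0 / 12 + 0 / 12) at_top"
    by (intro tendsto_intros g shift) auto
  thus ?thesis by (simp add: g_def stirling_rem_def[abs_def] algebra_simps)
qed

section \<open>Monotonicity of the Stirling remainder\<close>

text \<open>The signed difference \<open>d\<close> over a step \<open>h\<close> decreases strictly
  under \<open>x \<mapsto> x + 1\<close>, because the two shifts commute and
  \<open>stirling_diff\<close> is monotone. Since \<open>d\<close> tends to 0 along
  \<open>u + n\<close>, it is positive at \<open>u\<close>.\<close>

lemma stirling_rem_strict_mono:
  fixes \<sigma> :: real
  assumes "a \<ge> 0" "c \<ge> 0" "c < u" "u < v"
    and sgn: "\<And>y. y > c \<Longrightarrow> \<sigma> * ((y + a)\<^sup>2 - y * (y + 1)) > 0"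
  shows "\<sigma> * stirling_rem a v < \<sigma> * stirling_rem a u"
proof -
  define h where "h = v - u"
  define d where "d x = \<sigma> * (stirling_rem a x - stirling_rem a (x + h))" for x
  have h: "h > 0" using assms by (simp add: h_def)
  have step: "d (x + 1) < d x" if "x > c" for x
  proof -
    have "\<sigma> * stirling_diff a (x + h) < \<sigma> * stirling_diff a x"
      by (rule stirling_diff_strict_mono[OF assms(1,2) that _ sgn]) (use h in auto)
    moreover have "d x - d (x + 1) = \<sigma> * stirling_diff a x - \<sigma> * stirling_diff a (x + h)"
      using stirling_rem_diff[of x a] stirling_rem_diff[of "x + h" a] that assms h
      by (simp add: d_def flip: right_diff_distrib) (simp add: add_ac)
    ultimately show ?thesis by simp
  qed
  \<comment> \<open>The sequence starts at \<open>u + 1\<close>: its limit only gives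
    \<open>0 \<le> d (u + 1)\<close>, and one more \<open>step\<close> from \<open>u\<close> yields
    strictness.\<close>
  have "decseq (\<lambda>n. d (u + 1 + real n))"
  proof (rule decseq_SucI)
    fix n show "d (u + 1 + real (Suc n)) \<le> d (u + 1 + real n)"
      using step[of "u + 1 + real n"] assms by (simp add: add_ac)
  qed
  moreover have "(\<lambda>n. d (u + 1 + real n)) \<longlonglongrightarrow> 0"
  proof -
    have "(d \<longlongrightarrow> \<sigma> * 0) at_top"
      unfolding d_def[abs_def] by (intro tendsto_intros stirling_rem_shift_tendsto h)
    moreover have "filterlim (\<lambda>n. u + 1 + real n) at_top sequentially" by real_asymp
    ultimately show ?thesis by (auto intro: filterlim_compose)
  qed
  ultimately have "0 \<le> d (u + 1 + real 0)" by (rule decseq_ge)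
  also have "\<dots> < d u" using step[of u] assms by simp
  finally show ?thesis by (simp add: d_def h_def algebra_simps)
qed

section \<open>Behaviour at 0 and translation of the Gamma quotient\<close>

text \<open>After replacing \<open>ln_Gamma x\<close> by \<open>ln_Gamma (x + 1) - ln x\<close>, the
  only unbounded term is \<open>- (x + 1/2) * ln x\<close>; \<open>b > 0\<close> keeps the trigamma
  term away from its pole.\<close>

lemma stirling_rem_at_right_0:
  assumes "b > 0"
  shows "filterlim (stirling_rem b) at_top (at_right 0)"
proof -
  have cont: "((\<lambda>x. ln_Gamma (x + 1) + x - Polygamma 1 (x + b) / 12) \<longlongrightarrow>
                ln_Gamma (0 + 1) + 0 - Polygamma 1 (0 + b) / 12) (at_right 0)"
  proof (intro tendsto_intros)
    have "isCont ln_Gamma (1 :: real)"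
      using has_field_derivative_ln_Gamma_real[of 1] by (intro DERIV_isCont) auto
    thus "((\<lambda>x::real. ln_Gamma (x + 1)) \<longlongrightarrow> ln_Gamma (0 + 1)) (at_right 0)"
      by (intro isCont_tendsto_compose[of _ ln_Gamma] tendsto_intros) auto
  qed (use assms pos_not_nonpos_Int in auto)
  have "filterlim (\<lambda>x. ln_Gamma (x + 1) + x - Polygamma 1 (x + b) / 12 + (- (x + 1/2) * ln x))
          at_top (at_right 0)"
    by (rule filterlim_tendsto_add_at_top[OF cont]) real_asymp
  moreover have "eventually (\<lambda>x. ln_Gamma (x + 1) + x - Polygamma 1 (x + b) / 12
        + (- (x + 1/2) * ln x) = stirling_rem b x) (at_right 0)"
    using eventually_at_right_less[of 0]
    by eventually_elim (simp add: ln_Gamma_plus1 stirling_rem_def algebra_simps)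
  ultimately show ?thesis using filterlim_cong by force
qed

text \<open>The trigamma terms inside \<open>stirling_rem\<close> are added back, so
  \<open>a\<close> is free and can be set to \<alpha> for the lower bound and to \<beta> for the
  upper one.\<close>

lemma Gamma_ratio_conv_exp:
  assumes "u > 0" "v > 0"
  shows "Gamma u / Gamma v * (v powr (v - 1/2) / u powr (u - 1/2)) =
    exp (v - u + (stirling_rem a u + Polygamma 1 (u + a) / 12)
               - (stirling_rem a v + Polygamma 1 (v + a) / 12))"
proof -
  have "Gamma u / Gamma v * (v powr (v - 1/2) / u powr (u - 1/2)) =
    exp ((ln_Gamma u - ln_Gamma v) + ((v - 1/2) * ln v - (u - 1/2) * ln u))"
    unfolding exp_add exp_diff using assms by (simp add: Gamma_real_pos_exp powr_def)
  also have "(ln_Gamma u - ln_Gamma v) + ((v - 1/2) * ln v - (u - 1/2) * ln u) =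
      v - u + (stirling_rem a u + Polygamma 1 (u + a) / 12)
            - (stirling_rem a v + Polygamma 1 (v + a) / 12)"
    by (simp add: stirling_rem_def)
  finally show ?thesis .
qed

lemma isCont_stirling_rem:
  assumes "x > 0" "b \<ge> 0"
  shows "isCont (stirling_rem b) x"
proof -
  have "isCont ln_Gamma x"
    using has_field_derivative_ln_Gamma_real[of x] assms by (intro DERIV_isCont) auto
  thus ?thesis unfolding stirling_rem_def[abs_def]
    using assms pos_not_nonpos_Int[of "x + b"]
    by (intro continuous_intros isCont_o2[where g = "Polygamma 1"]) auto
qed

section \<open>The sharp ranges of \<alpha> and \<beta>\<close>

theorem mainTheorem4:
  fixes s t \<alpha> \<beta> :: real
  assumes "s < t" and "\<beta> < \<alpha>" and "0 \<le> \<beta>"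
  shows "(\<forall>x\<in>{-s<..}.
            exp (t - s + (deriv Digamma (x + s + \<alpha>) - deriv Digamma (x + t + \<alpha>)) / 12)
              \<le> Gamma (x + s) / Gamma (x + t)
                 * ((x + t) powr (x + t - 1/2) / (x + s) powr (x + s - 1/2)) \<and>
            Gamma (x + s) / Gamma (x + t)
                 * ((x + t) powr (x + t - 1/2) / (x + s) powr (x + s - 1/2))
              \<le> exp (t - s + (deriv Digamma (x + s + \<beta>) - deriv Digamma (x + t + \<beta>)) / 12))
         \<longleftrightarrow> \<beta> = 0 \<and> \<alpha> \<ge> 1/2" (is "?L \<longleftrightarrow> ?R")
proof -
  define h where "h = t - s"
  have h: "h > 0" using assms by (simp add: h_def)
  have "?L \<longleftrightarrow> (\<forall>x\<in>{-s<..}. stirling_rem \<alpha> (x + t) \<le> stirling_rem \<alpha> (x + s) \<and>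
                             stirling_rem \<beta> (x + s) \<le> stirling_rem \<beta> (x + t))"
  proof (rule ball_cong[OF refl], rule arg_cong2[where f = "(\<and>)"])
    fix x assume "x \<in> {-s<..}"
    hence x: "x + s > 0" "x + t > 0" using assms by auto
    have trigamma: "deriv Digamma (x + s + a) = Polygamma 1 (x + s + a)"
      "deriv Digamma (x + t + a) = Polygamma 1 (x + t + a)" if "a \<ge> 0" for a
      using that x by (simp_all only: deriv_Digamma_eq_Polygamma(2) add_pos_nonneg)
    show "exp (t - s + (deriv Digamma (x + s + \<alpha>) - deriv Digamma (x + t + \<alpha>)) / 12)
              \<le> Gamma (x + s) / Gamma (x + t)
                 * ((x + t) powr (x + t - 1/2) / (x + s) powr (x + s - 1/2))
          \<longleftrightarrow> stirling_rem \<alpha> (x + t) \<le> stirling_rem \<alpha> (x + s)"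
      unfolding Gamma_ratio_conv_exp[OF x, of \<alpha>] exp_le_cancel_iff
      using trigamma[of \<alpha>] assms by (auto simp: diff_divide_distrib)
    show "Gamma (x + s) / Gamma (x + t)
                 * ((x + t) powr (x + t - 1/2) / (x + s) powr (x + s - 1/2))
              \<le> exp (t - s + (deriv Digamma (x + s + \<beta>) - deriv Digamma (x + t + \<beta>)) / 12)
          \<longleftrightarrow> stirling_rem \<beta> (x + s) \<le> stirling_rem \<beta> (x + t)"
      unfolding Gamma_ratio_conv_exp[OF x, of \<beta>] exp_le_cancel_iff
      using trigamma[of \<beta>] assms by (auto simp: diff_divide_distrib)
  qed
  \<comment> \<open>Substitution \<open>u = x + s\<close>, which maps \<open>{-s<..}\<close> onto
    the positive reals.\<close>
  also have "\<dots> \<longleftrightarrow> (\<forall>u>0. stirling_rem \<alpha> (u + h) \<le> stirling_rem \<alpha> u \<and>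
                             stirling_rem \<beta> u \<le> stirling_rem \<beta> (u + h))" (is "_ \<longleftrightarrow> ?M")
  proof (intro iffI allI ballI impI)
    fix u :: real
    assume *: "\<forall>x\<in>{-s<..}. stirling_rem \<alpha> (x + t) \<le> stirling_rem \<alpha> (x + s) \<and>
                 stirling_rem \<beta> (x + s) \<le> stirling_rem \<beta> (x + t)" and "u > 0"
    from bspec[OF *, of "u - s"] \<open>u > 0\<close>
    show "stirling_rem \<alpha> (u + h) \<le> stirling_rem \<alpha> u \<and> stirling_rem \<beta> u \<le> stirling_rem \<beta> (u + h)"
      by (simp_all add: h_def algebra_simps)
  next
    fix x :: real
    assume *: ?M and "x \<in> {-s<..}"
    from *[rule_format, of "x + s"] \<open>x \<in> {-s<..}\<close>
    show "stirling_rem \<alpha> (x + t) \<le> stirling_rem \<alpha> (x + s) \<and>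
          stirling_rem \<beta> (x + s) \<le> stirling_rem \<beta> (x + t)"
      by (simp_all add: h_def)
  qed
  also have "?M \<longleftrightarrow> ?R"
  proof
    assume M: ?M
    have "\<beta> = 0"
    proof (rule ccontr)
      assume "\<beta> \<noteq> 0"
      hence \<beta>: "\<beta> > 0" using assms by simp
      \<comment> \<open>As \<open>u\<close> tends to 0 the right side of the \<beta> inequality
        stays bounded, by continuity at \<open>h\<close>, while its left side is unbounded.\<close>
      have "((\<lambda>u. stirling_rem \<beta> (u + h)) \<longlongrightarrow> stirling_rem \<beta> (0 + h)) (at_right 0)"
        using h \<beta> by (intro isCont_tendsto_compose[of _ "stirling_rem \<beta>"] isCont_stirling_rem
            tendsto_intros) auto
      hence "eventually (\<lambda>u. stirling_rem \<beta> (u + h) < stirling_rem \<beta> h + 1) (at_right 0)"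
        by (rule order_tendstoD) simp
      moreover have "eventually (\<lambda>u. stirling_rem \<beta> u > stirling_rem \<beta> h + 1) (at_right 0)"
        using stirling_rem_at_right_0[OF \<beta>] by (simp add: filterlim_at_top_dense)
      moreover have "eventually (\<lambda>u. u > 0) (at_right (0::real))"
        by (rule eventually_at_right_less)
      ultimately have "eventually (\<lambda>u::real. False) (at_right 0)"
        by eventually_elim (use M in force)
      thus False by simp
    qed
    moreover have "\<alpha> \<ge> 1/2"
    proof (rule ccontr)
      assume "\<not> \<alpha> \<ge> 1/2"
      hence \<alpha>: "1 - 2 * \<alpha> > 0" "\<alpha> > 0" using assms by auto
      \<comment> \<open>Since \<open>(y + \<alpha>)^2 - y * (y + 1) = \<alpha>^2 - y * (1 - 2 *
        \<alpha>)\<close>, this is the point beyond which the expression is negative;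
        \<open>c + 1\<close> is then a counterexample.\<close>
      define c where "c = \<alpha>\<^sup>2 / (1 - 2 * \<alpha>)"
      have c: "c \<ge> 0" using \<alpha> by (simp add: c_def)
      have "-1 * stirling_rem \<alpha> (c + 1 + h) < -1 * stirling_rem \<alpha> (c + 1)"
      proof (rule stirling_rem_strict_mono[OF _ c])
        fix y assume "y > c"
        hence "\<alpha>\<^sup>2 < y * (1 - 2 * \<alpha>)" using \<alpha> by (simp add: c_def pos_divide_less_eq)
        thus "-1 * ((y + \<alpha>)\<^sup>2 - y * (y + 1)) > 0"
          by (simp add: power2_eq_square algebra_simps)
      qed (use \<alpha> h in auto)
      moreover have "stirling_rem \<alpha> (c + 1 + h) \<le> stirling_rem \<alpha> (c + 1)" using M c by simp
      ultimately show False by simp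
    qed
    ultimately show ?R by simp
  next
    assume R: ?R
    show ?M
    proof (intro allI impI conjI)
      fix u :: real assume u: "u > 0"
      have "1 * stirling_rem \<alpha> (u + h) < 1 * stirling_rem \<alpha> u"
      proof (rule stirling_rem_strict_mono[OF _ order.refl])
        fix y :: real assume "y > 0"
        \<comment> \<open>The expression equals
          \<open>(2 * \<alpha> - 1) * y + \<alpha>^2\<close>.\<close>
        hence "y \<le> 2 * \<alpha> * y" "\<alpha>\<^sup>2 > 0" using R by auto
        thus "1 * ((y + \<alpha>)\<^sup>2 - y * (y + 1)) > 0"
          by (simp add: power2_eq_square algebra_simps)
      qed (use R h u in auto)
      thus "stirling_rem \<alpha> (u + h) \<le> stirling_rem \<alpha> u" by simp
      \<comment> \<open>With \<beta> = 0 the sign condition reduces to \<open>y > 0\<close>.\<close>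
      have "-1 * stirling_rem \<beta> (u + h) < -1 * stirling_rem \<beta> u"
        by (rule stirling_rem_strict_mono[OF _ order.refl])
           (use R h u in \<open>auto simp: power2_eq_square algebra_simps\<close>)
      thus "stirling_rem \<beta> u \<le> stirling_rem \<beta> (u + h)" by simp
    qed
  qed
  finally show ?thesis .
qed

end
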